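(* Let $\Gamma$ be a finite abelian group with $\Gamma(3)=\emptyset$, and let $S\subseteq\Gamma$ be skew-symmetric with $0\notin S$. Then the oriented Cayley graph $\mathrm{Cay}(\Gamma,S)$ is HS-integral if and only if $S=\emptyset$.
   Context: $\Gamma$ is written additively. $\Gamma(3)$ is the set of elements of $\Gamma$ whose order is divisible by $3$. A set $S$ is skew-symmetric if $-a\notin S$ for all $a\in S$. $\mathrm{Cay}(\Gamma,S)$ has vertex set $\Gamma$ and arcs $(a,b)$ with $b-a\in S$. Its Hermitian adjacency matrix of second kind $\mathcal{H}=(h_{uv})$ has $h_{uv}=1$ if both $(u,v)$ and $(v,u)$ are arcs, $h_{uv}=\frac{1+i\sqrt3}{2}$ if only $(u,v)$ is an arc, $h_{uv}=\frac{1-i\sqrt3}{2}$ if only $(v,u)$ is an arc, and $h_{uv}=0$ otherwise. The graph is HS-integral if all eigenvalues of $\mathcal{H}$ are integers. *)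

theory Defs
  imports "HOL-Analysis.Analysis" "HOL-Algebra.Multiplicative_Group"
begin

definition additive_group :: "'a::ab_group_add monoid"
  where "additive_group = \<lparr>carrier = UNIV, monoid.mult = (+), one = 0\<rparr>"

lemma comm_group_additive_group: "comm_group (additive_group :: 'a::ab_group_add monoid)"
  by (rule comm_groupI) (auto simp: additive_group_def algebra_simps intro: exI[of _ "- _"])

definition add_order :: "'a::ab_group_add \<Rightarrow> nat"
  where "add_order a = group.ord additive_group a"

definition order_div_3 :: "'a::ab_group_add set"
  where "order_div_3 = {a. 3 dvd add_order a}"

definition skew_symmetric :: "'a::ab_group_add set \<Rightarrow> bool"
  where "skew_symmetric S \<longleftrightarrow> (\<forall>a\<in>S. - a \<notin> S)"

text \<open>A directed graph whose vertex set is a whole (finite) type is given by its set of arcs.\<close>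

definition Cay :: "'a::ab_group_add set \<Rightarrow> ('a \<times> 'a) set"
  where "Cay S = {(a, b). b - a \<in> S}"

definition hermitian_adj :: "('v::finite \<times> 'v) set \<Rightarrow> complex^'v^'v"
  where "hermitian_adj E = (\<chi> u v.
    if (u, v) \<in> E \<and> (v, u) \<in> E then 1
    else if (u, v) \<in> E then (1 + \<i> * complex_of_real (sqrt 3)) / 2
    else if (v, u) \<in> E then (1 - \<i> * complex_of_real (sqrt 3)) / 2
    else 0)"

definition is_eigenvalue :: "complex^'n^'n::finite \<Rightarrow> complex \<Rightarrow> bool"
  where "is_eigenvalue A c \<longleftrightarrow> (\<exists>x. x \<noteq> 0 \<and> A *v x = c *s x)"

definition HS_integral :: "('v::finite \<times> 'v) set \<Rightarrow> bool"
  where "HS_integral E \<longleftrightarrow> (\<forall>c. is_eigenvalue (hermitian_adj E) c \<longrightarrow> c \<in> \<int>)"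

end

theory Submission
  imports Defs "HOL-Number_Theory.Residues"
begin

text \<open>
  For a character \<open>\<psi>\<close> of the group, the corresponding eigenvalue \<open>\<lambda>\<close> satisfies
  \<open>2\<lambda> = \<beta> + \<surd>-3 \<delta>\<close>, where \<open>\<beta>\<close> and \<open>\<delta>\<close> are the character sums of \<open>1\<^sub>S + 1\<^bsub>-S\<^esub>\<close> and
  \<open>1\<^sub>S - 1\<^bsub>-S\<^esub>\<close>. Both lie in the ring \<open>R\<close> generated by the \<open>n\<close>-th roots of unity for some \<open>n\<close>
  prime to 3. If \<open>\<lambda>\<close> is an integer, then \<open>\<gamma> = \<surd>-3 \<delta>\<close> lies in \<open>R\<close> too, and \<open>\<gamma>\<^sup>2 = -3 \<delta>\<^sup>2\<close>.
  Since an iterate of the Frobenius map is the identity on \<open>R/3R\<close>, this ring is reduced, so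
  \<open>3\<close> divides \<open>\<gamma>\<close>, then \<open>\<delta>\<close>, and infinite descent yields \<open>\<delta> = 0\<close>. As characters separate
  functions on the group, \<open>S = -S\<close>.
\<close>

section \<open>The ring generated by the roots of unity of order prime to 3\<close>

text \<open>Only additive closure is built in; products come for free because the
  \<open>n\<close>-th roots of unity are closed under multiplication. Inductions then have only
  additive cases, which suits the Frobenius map.\<close>

inductive_set cyclotomic_ring :: "nat \<Rightarrow> complex set" for n :: nat where
  root: "z ^ n = 1 \<Longrightarrow> z \<in> cyclotomic_ring n"
| add: "a \<in> cyclotomic_ring n \<Longrightarrow> b \<in> cyclotomic_ring n \<Longrightarrow> a + b \<in> cyclotomic_ring n"
| uminus: "a \<in> cyclotomic_ring n \<Longrightarrow> - a \<in> cyclotomic_ring n"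

lemma cyclotomic_ring_1: "1 \<in> cyclotomic_ring n"
  by (rule cyclotomic_ring.root) simp

lemma cyclotomic_ring_0: "0 \<in> cyclotomic_ring n"
  using cyclotomic_ring.add[OF cyclotomic_ring_1 cyclotomic_ring.uminus[OF cyclotomic_ring_1]]
  by simp

lemma cyclotomic_ring_diff:
  "a \<in> cyclotomic_ring n \<Longrightarrow> b \<in> cyclotomic_ring n \<Longrightarrow> a - b \<in> cyclotomic_ring n"
  using cyclotomic_ring.add[OF _ cyclotomic_ring.uminus, of a n b] by simp

lemma cyclotomic_ring_mult:
  assumes "a \<in> cyclotomic_ring n" "b \<in> cyclotomic_ring n"
  shows "a * b \<in> cyclotomic_ring n"
  using assms(1)
proof induction
  case (root z)
  from assms(2) show ?case
    by induction
      (use root in \<open>auto simp: distrib_left power_mult_distrib intro: cyclotomic_ring.intros\<close>)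
qed (auto simp: distrib_right intro: cyclotomic_ring.intros)

lemma cyclotomic_ring_power: "a \<in> cyclotomic_ring n \<Longrightarrow> a ^ k \<in> cyclotomic_ring n"
  by (induction k) (auto intro: cyclotomic_ring_1 cyclotomic_ring_mult)

lemma cyclotomic_ring_of_nat: "of_nat k \<in> cyclotomic_ring n"
  by (induction k) (auto intro: cyclotomic_ring_0 cyclotomic_ring_1 cyclotomic_ring.add)

lemma cyclotomic_ring_of_int: "of_int k \<in> cyclotomic_ring n"
  by (cases k rule: int_cases2)
    (auto intro: cyclotomic_ring_of_nat cyclotomic_ring.uminus)

lemma cyclotomic_ring_sum:
  "(\<And>i. i \<in> A \<Longrightarrow> f i \<in> cyclotomic_ring n) \<Longrightarrow> sum f A \<in> cyclotomic_ring n"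
  by (induction A rule: infinite_finite_induct)
    (auto intro: cyclotomic_ring_0 cyclotomic_ring.add)

text \<open>Cubing is additive modulo 3, because the middle binomial coefficients are divisible by
  3; this is iterated \<open>k\<close> times.\<close>

lemma cyclotomic_ring_frobenius_add:
  assumes "a \<in> cyclotomic_ring n" "b \<in> cyclotomic_ring n"
  shows "\<exists>q\<in>cyclotomic_ring n. (a + b) ^ (3 ^ k) = a ^ (3 ^ k) + b ^ (3 ^ k) + 3 * q"
proof (induction k)
  case 0
  show ?case by (auto intro: bexI[of _ 0] cyclotomic_ring_0)
next
  case (Suc k)
  define c d where "c = a ^ (3 ^ k)" and "d = b ^ (3 ^ k)"
  have cd: "c \<in> cyclotomic_ring n" "d \<in> cyclotomic_ring n"
    using assms by (auto simp: c_def d_def intro: cyclotomic_ring_power)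
  from Suc obtain q where q: "q \<in> cyclotomic_ring n" "(a + b) ^ (3 ^ k) = c + d + 3 * q"
    by (auto simp: c_def d_def)
  \<comment> \<open>What is left of \<open>(c + d + 3 * q) ^ 3\<close> after removing both cubes,
    divided by 3.\<close>
  define r where "r = c * c * d + c * d * d + 3 * ((c + d) * (c + d) * q)
    + 3 * (3 * ((c + d) * q * q)) + 3 * (3 * (q * q * q))"
  have three: "3 \<in> cyclotomic_ring n"
    using cyclotomic_ring_of_nat[of 3] by simp
  have "(a + b) ^ (3 ^ Suc k) = (c + d + 3 * q) ^ 3"
    unfolding q(2)[symmetric] by (simp add: power_mult[symmetric] mult.commute)
  also have "\<dots> = c ^ 3 + d ^ 3 + 3 * r"
    by (simp add: r_def power3_eq_cube algebra_simps)
  also have "c ^ 3 = a ^ (3 ^ Suc k)"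
    by (simp add: c_def power_mult[symmetric] mult.commute)
  also have "d ^ 3 = b ^ (3 ^ Suc k)"
    by (simp add: d_def power_mult[symmetric] mult.commute)
  finally have "(a + b) ^ (3 ^ Suc k) = a ^ (3 ^ Suc k) + b ^ (3 ^ Suc k) + 3 * r" .
  moreover have "r \<in> cyclotomic_ring n"
    unfolding r_def by (intro cyclotomic_ring.add cyclotomic_ring_mult cd q three)
  ultimately show ?case by blast
qed

text \<open>Exponents of a root of unity matter only modulo \<open>n\<close>, so the generators are
  fixed exactly. Additivity modulo 3 extends this to sums, and oddness of \<open>3 ^ k\<close> to
  negatives.\<close>

lemma cyclotomic_ring_frobenius:
  assumes "[3 ^ k = 1] (mod n)" "a \<in> cyclotomic_ring n"
  shows "\<exists>q\<in>cyclotomic_ring n. a ^ (3 ^ k) = a + 3 * q"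
  using assms(2)
proof induction
  case (root z)
  have "z ^ m = z ^ (m mod n)" for m
    by (metis mult_1 mult_div_mod_eq power_add power_mult power_one root)
  hence "z ^ (3 ^ k) = z ^ 1"
    using assms(1) unfolding cong_def by metis
  thus ?case by (auto intro: bexI[of _ 0] cyclotomic_ring_0)
next
  case (add a b)
  from add.IH obtain q1 q2 where q: "q1 \<in> cyclotomic_ring n" "q2 \<in> cyclotomic_ring n"
    "a ^ (3 ^ k) = a + 3 * q1" "b ^ (3 ^ k) = b + 3 * q2" by blast
  from cyclotomic_ring_frobenius_add[OF add.hyps] obtain q3
    where q3: "q3 \<in> cyclotomic_ring n" "(a + b) ^ (3 ^ k) = a ^ (3 ^ k) + b ^ (3 ^ k) + 3 * q3"
    by blast
  show ?case
    by (rule bexI[of _ "q1 + q2 + q3"])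
      (use q q3 in \<open>auto simp: algebra_simps intro: cyclotomic_ring.add\<close>)
next
  case (uminus a)
  then obtain q where q: "q \<in> cyclotomic_ring n" "a ^ (3 ^ k) = a + 3 * q" by blast
  have "(- a) ^ (3 ^ k) = - (a ^ (3 ^ k))" by (rule power_minus_odd) simp
  thus ?case
    by (intro bexI[of _ "- q"]) (use q in \<open>auto intro: cyclotomic_ring.uminus\<close>)
qed

text \<open>Euler's theorem gives a \<open>k\<close> for which \<open>a ^ (3 ^ k)\<close> is
  congruent to \<open>a\<close> modulo 3. Since \<open>3 ^ k\<close> is at least 2, this power has
  the factor \<open>a ^ 2\<close> and is therefore divisible by 3.\<close>

lemma cyclotomic_ring_mod_3_reduced:
  assumes "coprime 3 n" "n > 0" "a \<in> cyclotomic_ring n" "q \<in> cyclotomic_ring n" "a\<^sup>2 = 3 * q"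
  shows "\<exists>r\<in>cyclotomic_ring n. a = 3 * r"
proof -
  define k where "k = totient n"
  have "[3 ^ k = 1] (mod n)" unfolding k_def by (rule euler_theorem) fact
  from cyclotomic_ring_frobenius[OF this assms(3)]
  obtain p where p: "p \<in> cyclotomic_ring n" "a ^ (3 ^ k) = a + 3 * p" by blast
  have "k > 0" using assms(2) by (simp add: k_def)
  hence "(3::nat) ^ 1 \<le> 3 ^ k" by (intro power_increasing) auto
  hence "(3::nat) ^ k = 2 + (3 ^ k - 2)" by simp
  hence "a ^ (3 ^ k) = 3 * (q * a ^ (3 ^ k - 2))"
    by (metis assms(5) mult.assoc power_add)
  hence "a = 3 * (q * a ^ (3 ^ k - 2) - p)"
    using p(2) by (simp add: algebra_simps)
  moreover have "q * a ^ (3 ^ k - 2) - p \<in> cyclotomic_ring n"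
    by (intro cyclotomic_ring_diff cyclotomic_ring_mult cyclotomic_ring_power assms p)
  ultimately show ?thesis by blast
qed

text \<open>
  The ring is finitely generated as an additive group, so a \<open>\<rat>\<close>-linear functional that does not
  vanish at \<open>x\<close> takes values with bounded denominators on it.
\<close>

lemma cyclotomic_ring_infinitely_3_divisible:
  assumes "n > 0" and div: "\<And>k::nat. \<exists>y\<in>cyclotomic_ring n. x = 3 ^ k * y"
  shows "x = 0"
proof (rule ccontr)
  assume "x \<noteq> 0"
  interpret Q: vector_space "\<lambda>(q::rat) (z::complex). of_rat q * z"
    by unfold_locales (auto simp: algebra_simps of_rat_add of_rat_mult)
  \<comment> \<open>Extending \<open>{x}\<close> to a rational basis of the complex numbers makes
    the coordinate at \<open>x\<close> a functional with value 1 at \<open>x\<close>.\<close>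
  have ind: "Q.independent {x}"
    using \<open>x \<noteq> 0\<close> by simp
  define B where "B = Q.extend_basis {x}"
  have B: "Q.independent B" "Q.span B = UNIV" "x \<in> B"
    using Q.independent_extend_basis[OF ind] Q.span_extend_basis[OF ind]
      Q.extend_basis_superset[OF ind] by (auto simp: B_def)
  define \<phi> where "\<phi> z = Q.representation B z x" for z
  have \<phi>_add: "\<phi> (a + b) = \<phi> a + \<phi> b" for a b
    unfolding \<phi>_def using B by (subst Q.representation_add) auto
  have \<phi>_uminus: "\<phi> (- a) = - \<phi> a" for a
    unfolding \<phi>_def using B by (subst Q.representation_neg) auto
  have \<phi>_scale: "\<phi> (of_rat q * a) = q * \<phi> a" for q a
    unfolding \<phi>_def using B by (subst Q.representation_scale) auto
  have \<phi>_x: "\<phi> x = 1"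
    unfolding \<phi>_def using B by (subst Q.representation_basis) auto
  define U where "U = {z::complex. z ^ n = 1}"
  have "finite U"
    unfolding U_def using assms(1) by (intro finite_roots_unity) auto
  \<comment> \<open>A common denominator of the values of \<open>\<phi>\<close> on the finitely many
    generators; by additivity it works for the whole ring.\<close>
  define N where "N = (\<Prod>z\<in>U. snd (quotient_of (\<phi> z)))"
  have "N > 0"
    unfolding N_def by (intro prod_pos) (auto simp: quotient_of_denom_pos')
  have int: "of_int N * \<phi> a \<in> \<int>" if "a \<in> cyclotomic_ring n" for a
    using that
  proof induction
    case (root z)
    hence "z \<in> U" by (simp add: U_def)
    define p q where "p = fst (quotient_of (\<phi> z))" and "q = snd (quotient_of (\<phi> z))"
    have "\<phi> z = of_int p / of_int q"
      by (rule quotient_of_div) (simp add: p_def q_def)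
    moreover have "q > 0" by (simp add: q_def quotient_of_denom_pos')
    moreover have "N = q * (\<Prod>z\<in>U - {z}. snd (quotient_of (\<phi> z)))"
      unfolding N_def q_def using \<open>finite U\<close> \<open>z \<in> U\<close> by (rule prod.remove)
    ultimately have "of_int N * \<phi> z = of_int ((\<Prod>z\<in>U - {z}. snd (quotient_of (\<phi> z))) * p)"
      by simp
    thus ?case by (simp only: Ints_of_int)
  qed (auto simp: \<phi>_add \<phi>_uminus distrib_left)
  have dvd: "3 ^ k dvd N" for k :: nat
  proof -
    from div obtain y where y: "y \<in> cyclotomic_ring n" "x = 3 ^ k * y" by blast
    from int[OF y(1)] obtain m where m: "of_int N * \<phi> y = of_int m" by (elim Ints_cases)
    \<comment> \<open>So \<open>\<phi> y\<close> is \<open>1 / 3 ^ k\<close>, and integrality of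
      \<open>N * \<phi> y\<close> forces \<open>3 ^ k\<close> to divide \<open>N\<close>, for every
      \<open>k\<close>.\<close>
    have "1 = 3 ^ k * \<phi> y"
      using \<phi>_scale[of "3 ^ k" y] \<phi>_x y(2) by (simp add: of_rat_power)
    hence "of_int N = (3 ^ k * of_int m :: rat)"
      unfolding m[symmetric] by (simp add: mult.left_commute)
    hence "N = 3 ^ k * m"
      by (metis of_int_eq_iff of_int_mult of_int_numeral of_int_power)
    thus ?thesis by simp
  qed
  obtain k where "real_of_int N < 3 ^ k"
    using real_arch_pow[of 3 "real_of_int N"] by auto
  hence "N < 3 ^ k"
    by (metis of_int_less_iff of_int_numeral of_int_power)
  with zdvd_imp_le[OF dvd[of k] \<open>N > 0\<close>] show False by simp
qed

text \<open>The descent carries \<open>t * y\<close> along with \<open>y\<close>: its membership in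
  the ring is what lets the next factor 3 be extracted.\<close>

lemma sqrt_minus_3_mult_cyclotomic_ring_imp_0:
  assumes "coprime 3 n" "n > 0" "x \<in> cyclotomic_ring n" "t * x \<in> cyclotomic_ring n"
    and t: "t\<^sup>2 = - 3"
  shows "x = 0"
proof (rule cyclotomic_ring_infinitely_3_divisible[OF assms(2)])
  fix k :: nat
  have "\<exists>y\<in>cyclotomic_ring n. t * y \<in> cyclotomic_ring n \<and> x = 3 ^ k * y"
  proof (induction k)
    case 0
    show ?case using assms by auto
  next
    case (Suc k)
    then obtain y where y: "y \<in> cyclotomic_ring n" "t * y \<in> cyclotomic_ring n" "x = 3 ^ k * y"
      by blast
    \<comment> \<open>First 3 divides \<open>t * y\<close>; squaring \<open>t * y = 3 * z\<close>
      and cancelling \<open>- 3\<close> then shows that 3 divides \<open>y\<close> as well.\<close>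
    have "(t * y)\<^sup>2 = 3 * (- (y * y))"
      by (simp add: power_mult_distrib t power2_eq_square[of y])
    then obtain z where z: "z \<in> cyclotomic_ring n" "t * y = 3 * z"
      using cyclotomic_ring_mod_3_reduced[OF assms(1,2) y(2)
        cyclotomic_ring.uminus[OF cyclotomic_ring_mult[OF y(1) y(1)]]] by metis
    have "t\<^sup>2 * y\<^sup>2 = 9 * (z * z)"
      unfolding power_mult_distrib[symmetric] z(2) by (simp add: power2_eq_square)
    hence "- 3 * y\<^sup>2 = - 3 * (3 * (- (z * z)))" unfolding t by simp
    hence "y\<^sup>2 = 3 * (- (z * z))" by (simp only: mult_cancel_left) simp
    then obtain w where w: "w \<in> cyclotomic_ring n" "y = 3 * w"
      using cyclotomic_ring_mod_3_reduced[OF assms(1,2) y(1)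
        cyclotomic_ring.uminus[OF cyclotomic_ring_mult[OF z(1) z(1)]]] by metis
    \<comment> \<open>This restores the invariant for \<open>w\<close>, since \<open>z\<close> lies
      in the ring.\<close>
    have "t * w = z" using z(2) w(2) by simp
    thus ?case using w y(3) z(1) by (intro bexI[of _ w]) auto
  qed
  thus "\<exists>y\<in>cyclotomic_ring n. x = 3 ^ k * y" by blast
qed

section \<open>Characters of finite abelian groups\<close>

definition character :: "('a::ab_group_add \<Rightarrow> complex) \<Rightarrow> bool"
  where "character \<psi> \<longleftrightarrow> \<psi> 0 = 1 \<and> (\<forall>x y. \<psi> (x + y) = \<psi> x * \<psi> y)"

abbreviation multiple :: "'a::ab_group_add \<Rightarrow> nat \<Rightarrow> 'a"
  where "multiple g k \<equiv> g [^]\<^bsub>additive_group\<^esub> k"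

lemma multiple_0: "multiple g 0 = 0"
  by (simp add: additive_group_def)

lemma multiple_Suc: "multiple g (Suc k) = multiple g k + g"
  by (simp add: additive_group_def)

lemma multiple_add_order: "multiple g (add_order g) = 0"
proof -
  interpret comm_group "additive_group :: 'a monoid" by (rule comm_group_additive_group)
  have "multiple g (add_order g) = \<one>\<^bsub>additive_group\<^esub>"
    unfolding add_order_def by (rule pow_ord_eq_1) (simp add: additive_group_def)
  thus ?thesis by (simp add: additive_group_def)
qed

lemma add_order_pos: "add_order (g :: 'a::{finite, ab_group_add}) > 0"
proof -
  interpret comm_group "additive_group :: 'a monoid" by (rule comm_group_additive_group)
  show ?thesis
    unfolding add_order_def using ord_ge_1[of g] by (simp add: additive_group_def)
qed

lemma character_multiple: "character \<psi> \<Longrightarrow> \<psi> (multiple g k) = \<psi> g ^ k"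
  by (induction k)
    (simp_all add: character_def multiple_0 multiple_Suc mult.commute del: nat_pow_Suc nat_pow_0)

lemma character_uminus: "character \<psi> \<Longrightarrow> \<psi> x * \<psi> (- x) = 1"
  unfolding character_def by (metis add.right_inverse)

lemma sum_translate:
  fixes F :: "'a::{finite, ab_group_add} \<Rightarrow> complex"
  shows "(\<Sum>x\<in>UNIV. F (x + h)) = (\<Sum>x\<in>UNIV. F x)"
  by (rule sum.reindex_bij_witness[of _ "\<lambda>x. x - h" "\<lambda>x. x + h"]) auto

text \<open>
  The projection of \<open>u\<close> to some eigenspace of the translation by \<open>g\<close> is nonzero, because the
  projections add up to \<open>u\<close>.
\<close>

lemma translation_eigenvector:
  fixes u :: "'a::{finite, ab_group_add} \<Rightarrow> complex"
  assumes "u x0 \<noteq> 0"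
  shows "\<exists>(d::nat) a c y. (\<Sum>j<d. a j * u (y + multiple g j)) \<noteq> 0 \<and>
    (\<forall>x. (\<Sum>j<d. a j * u (x + g + multiple g j)) = c * (\<Sum>j<d. a j * u (x + multiple g j)))"
proof -
  define d where "d = add_order g"
  have d: "d > 0" by (simp add: d_def add_order_pos)
  define w where "w = cis (2 * pi / d)"
  \<comment> \<open>Up to the factor \<open>d\<close>, the projection to the functions that
    translation by \<open>g\<close> multiplies by the inverse of \<open>w ^ k\<close>.\<close>
  define V where "V k x = (\<Sum>j<d. (w ^ k) ^ j * u (x + multiple g j))" for k x
  have wd: "w ^ d = 1" using d unfolding w_def Complex.DeMoivre by simp
  have w0: "w \<noteq> 0" by (simp add: w_def)
  have w1: "w ^ j \<noteq> 1" if "0 < j" "j < d" for j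
  proof
    assume "w ^ j = 1"
    hence "cis (2 * pi * j / d) = cis (2 * pi * 0 / d)" unfolding w_def Complex.DeMoivre by (simp add: mult_ac)
    moreover have "inj_on (\<lambda>k. cis (2 * pi * real k / real d)) {..<d}"
      using Complex.bij_betw_roots_unity[OF d] by (simp add: bij_betw_def)
    ultimately show False using that d inj_onD[of "\<lambda>k. cis (2 * pi * real k / real d)" "{..<d}" j 0]
      by auto
  qed
  have shift: "w ^ k * V k (x + g) = V k x" for k x
  proof -
    define F where "F j = (w ^ k) ^ j * u (x + multiple g j)" for j
    have "w ^ k * V k (x + g) = (\<Sum>j<d. F (Suc j))"
      unfolding V_def sum_distrib_left
      by (rule sum.cong) (simp_all add: F_def multiple_Suc ac_simps del: nat_pow_Suc)
    \<comment> \<open>The shifted sum differs only in its end terms, which agree because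
      \<open>w ^ d = 1\<close> and the \<open>d\<close>-th multiple of \<open>g\<close> is
      0.\<close>
    also have "\<dots> = (\<Sum>j<d. F j) + F d - F 0"
      by (induction d) simp_all
    also have "F d = F 0"
      using multiple_add_order[of g] wd
      by (simp add: F_def d_def multiple_0 power_mult[symmetric] mult.commute[of k] power_mult[of w]
          del: nat_pow_0)
    finally show ?thesis by (simp add: V_def F_def)
  qed
  \<comment> \<open>Summed over \<open>k\<close>, the geometric sums cancel all terms but
    \<open>j = 0\<close>, so some \<open>V k x0\<close> is nonzero.\<close>
  have "(\<Sum>k<d. V k x0) = (\<Sum>j<d. (\<Sum>k<d. (w ^ j) ^ k) * u (x0 + multiple g j))"
    unfolding V_def sum_distrib_right
    by (subst sum.swap) (simp add: power_mult[symmetric] mult.commute)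
  also have "\<dots> = (\<Sum>j<d. if j = 0 then d * u x0 else 0)"
  proof (rule sum.cong)
    fix j assume j: "j \<in> {..<d}"
    have "(\<Sum>k<d. (w ^ j) ^ k) = 0" if "j \<noteq> 0"
    proof -
      have "(w ^ j) ^ d = 1"
        by (metis wd power_mult mult.commute power_one)
      thus ?thesis using w1[of j] that j by (simp add: geometric_sum)
    qed
    thus "(\<Sum>k<d. (w ^ j) ^ k) * u (x0 + multiple g j) = (if j = 0 then d * u x0 else 0)"
      by (auto simp: multiple_0 simp del: nat_pow_0)
  qed simp
  also have "\<dots> = d * u x0" using d by simp
  also have "\<dots> \<noteq> 0" using d assms by simp
  finally obtain k where k: "V k x0 \<noteq> 0" by (meson sum.neutral)
  have "V k (x + g) = inverse (w ^ k) * V k x" for x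
    using shift[of k x] w0 by (simp add: field_simps)
  with k show ?thesis unfolding V_def by blast
qed

text \<open>A counterexample would yield a common eigenvector of all translations among the
  functions annihilated by every character. Such an eigenvector is a multiple of a character, and
  pairing it with the inverse character gives a nonzero value.\<close>

lemma characters_separate:
  fixes f :: "'a::{finite, ab_group_add} \<Rightarrow> complex"
  assumes zero: "\<And>\<psi>. character \<psi> \<Longrightarrow> (\<Sum>x\<in>UNIV. f x * \<psi> x) = 0"
  shows "f x = 0"
proof (rule ccontr)
  assume fx: "f x \<noteq> 0"
  define W where "W = {u :: 'a \<Rightarrow> complex. \<forall>\<psi>. character \<psi> \<longrightarrow> (\<Sum>x\<in>UNIV. u x * \<psi> x) = 0}"
  have W_closed: "(\<lambda>x. \<Sum>j<(d::nat). a j * u (x + h j)) \<in> W" if "u \<in> W"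
    for d a and u :: "'a \<Rightarrow> complex" and h :: "nat \<Rightarrow> 'a"
  proof -
    have "(\<Sum>x\<in>UNIV. (\<Sum>j<d. a j * u (x + h j)) * \<psi> x) = 0" if "character \<psi>" for \<psi>
    proof -
      have "(\<Sum>x\<in>UNIV. (\<Sum>j<d. a j * u (x + h j)) * \<psi> x)
          = (\<Sum>j<d. \<Sum>x\<in>UNIV. a j * (u (x + h j) * \<psi> x))"
        unfolding sum_distrib_right by (subst sum.swap) (simp add: mult.assoc)
      also have "\<dots> = (\<Sum>j<d. a j * \<psi> (- h j) * (\<Sum>x\<in>UNIV. u (x + h j) * \<psi> (x + h j)))"
        unfolding sum_distrib_left
      proof (intro sum.cong refl)
        fix x j
        have "\<psi> (x + h j) * \<psi> (- h j) = \<psi> x"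
          using that unfolding character_def by (metis add_diff_cancel_right' diff_conv_add_uminus)
        thus "a j * (u (x + h j) * \<psi> x) = a j * \<psi> (- h j) * (u (x + h j) * \<psi> (x + h j))"
          by (metis mult.assoc mult.commute)
      qed
      also have "\<dots> = 0"
        using \<open>u \<in> W\<close> that by (simp add: W_def sum_translate[of "\<lambda>x. u x * \<psi> x"])
      finally show ?thesis .
    qed
    thus ?thesis by (simp add: W_def)
  qed
  \<comment> \<open>Group elements are treated one at a time. Each new function combines translates
    of the old one, so it stays in \<open>W\<close> and keeps the eigenvalues already
    obtained.\<close>
  have "\<exists>u\<in>W. (\<exists>x. u x \<noteq> 0) \<and> (\<forall>g\<in>G. \<exists>c. \<forall>x. u (x + g) = c * u x)" for G :: "'a set"
    using finite[of G]
  proof (induction G rule: finite_induct)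
    case empty
    have "f \<in> W" using zero by (simp add: W_def)
    thus ?case using fx by auto
  next
    case (insert g G)
    then obtain u x0 where u: "u \<in> W" "u x0 \<noteq> 0" "\<forall>g\<in>G. \<exists>c. \<forall>x. u (x + g) = c * u x" by blast
    from translation_eigenvector[of u, OF u(2), of g] obtain d a c y
      where v: "(\<Sum>j<(d::nat). a j * u (y + multiple g j)) \<noteq> 0"
        "\<forall>x. (\<Sum>j<d. a j * u (x + g + multiple g j)) = c * (\<Sum>j<d. a j * u (x + multiple g j))"
      by blast
    define v where "v x = (\<Sum>j<d. a j * u (x + multiple g j))" for x
    have "v \<in> W" using W_closed[OF u(1)] by (simp add: v_def[abs_def])
    moreover have "v y \<noteq> 0" using v by (simp add: v_def)
    moreover have "\<exists>c. \<forall>x. v (x + h) = c * v x" if "h \<in> G" for h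
    proof -
      from u(3) that obtain b where b: "u (x + h) = b * u x" for x by blast
      have "v (x + h) = b * v x" for x
        using b[of "x + multiple g _"]
        by (simp add: v_def sum_distrib_left ac_simps)
      thus ?thesis by blast
    qed
    moreover have "\<exists>c. \<forall>x. v (x + g) = c * v x" using v by (auto simp: v_def)
    ultimately show ?case by blast
  qed
  from this[of UNIV] obtain u x0 c
    where u: "u \<in> W" "u x0 \<noteq> 0" and c: "\<And>g x. u (x + g) = c g * u x" by (metis UNIV_I)
  have u0: "u 0 \<noteq> 0" using u(2) c[of 0 x0] by auto
  have u_c: "u g = c g * u 0" for g using c[of 0 g] by simp
  have c_add: "c (x + y) = c x * c y" for x y
    using c[of x y] u_c[of "x + y"] u_c[of x] u0 by simp
  have c0: "c 0 = 1" using u_c[of 0] u0 by simp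
  have char: "character c" using c_add c0 by (simp add: character_def)
  have "character (\<lambda>x. c (- x))"
    using c0 by (simp add: character_def c_add[symmetric])
  hence "0 = (\<Sum>x\<in>UNIV. u x * c (- x))" using u(1) by (simp add: W_def)
  also have "\<dots> = (\<Sum>x\<in>(UNIV::'a set). u 0)"
  proof (rule sum.cong)
    fix x
    have "u x * c (- x) = u 0 * (c x * c (- x))" unfolding u_c[of x] by (simp only: ac_simps)
    thus "u x * c (- x) = u 0" by (simp add: character_uminus[OF char])
  qed simp
  finally show False using u0 by simp
qed

section \<open>Integral eigenvalues\<close>

text \<open>The matrix entry at \<open>u\<close>, \<open>v\<close> depends only on
  \<open>v - u\<close>, so the matrix acts as a convolution and has the characters as eigenvectors.
  Skew-symmetry rules out the entry 1.\<close>

lemma hermitian_adj_Cay_character: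
  fixes S :: "'a::{finite, ab_group_add} set"
  assumes "skew_symmetric S" "character \<psi>"
  defines "w \<equiv> \<lambda>s. if s \<in> S then (1 + \<i> * complex_of_real (sqrt 3)) / 2
    else if - s \<in> S then (1 - \<i> * complex_of_real (sqrt 3)) / 2 else 0"
  shows "is_eigenvalue (hermitian_adj (Cay S)) (\<Sum>s\<in>UNIV. w s * \<psi> s)"
proof -
  define x :: "(complex, 'a) vec" where "x = (\<chi> v. \<psi> v)"
  have "x $ 0 \<noteq> 0" using assms(2) by (simp add: x_def character_def)
  hence "x \<noteq> 0" by auto
  moreover have "hermitian_adj (Cay S) *v x = (\<Sum>s\<in>UNIV. w s * \<psi> s) *s x"
  proof (rule vec_eq_iff[THEN iffD2], rule allI)
    fix u :: 'a
    have "hermitian_adj (Cay S) $ u $ v = w (v - u)" for v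
      using assms(1) unfolding hermitian_adj_def Cay_def w_def skew_symmetric_def
      by auto
    hence "(hermitian_adj (Cay S) *v x) $ u = (\<Sum>v\<in>UNIV. w (v - u) * \<psi> v)"
      by (simp add: matrix_vector_mult_def x_def)
    also have "\<dots> = (\<Sum>v\<in>UNIV. w v * \<psi> (v + u))"
      using sum_translate[of "\<lambda>v. w (v - u) * \<psi> v" u] by simp
    also have "\<dots> = (\<Sum>s\<in>UNIV. w s * \<psi> s) * \<psi> u"
      using assms(2) by (simp add: character_def sum_distrib_right mult.assoc)
    finally show "(hermitian_adj (Cay S) *v x) $ u = ((\<Sum>s\<in>UNIV. w s * \<psi> s) *s x) $ u"
      by (simp add: x_def)
  qed
  ultimately show ?thesis unfolding is_eigenvalue_def by blast
qed

lemma HS_integral_empty: "HS_integral (Cay ({} :: 'a::{finite, ab_group_add} set))"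
proof -
  have "hermitian_adj (Cay ({} :: 'a set)) = 0"
    by (simp add: hermitian_adj_def Cay_def vec_eq_iff)
  thus ?thesis
    by (auto simp: HS_integral_def is_eigenvalue_def)
qed

theorem theorem3p2:
  fixes S :: "'a::{finite, ab_group_add} set"
  assumes "(order_div_3 :: 'a set) = {}"
    and "skew_symmetric S"
    and "0 \<notin> S"
  shows "HS_integral (Cay S) \<longleftrightarrow> S = {}"
proof
  assume "S = {}"
  thus "HS_integral (Cay S)" by (simp add: HS_integral_empty)
next
  assume integral: "HS_integral (Cay S)"
  \<comment> \<open>A multiple of every element order that is still prime to 3, so that all
    character values are \<open>n\<close>-th roots of unity.\<close>
  define n where "n = (\<Prod>g\<in>(UNIV::'a set). add_order g)"
  have "n > 0" unfolding n_def by (intro prod_pos) (simp add: add_order_pos)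
  have "coprime 3 n"
    unfolding n_def
  proof (rule prod_coprime_right)
    fix g :: 'a
    have "\<not> 3 dvd add_order g" using assms(1) by (auto simp: order_div_3_def)
    thus "coprime 3 (add_order g)" by (intro prime_imp_coprime) auto
  qed
  define t where "t = \<i> * complex_of_real (sqrt 3)"
  have t: "t\<^sup>2 = - 3" by (simp add: t_def power_mult_distrib flip: of_real_power)
  define f b :: "'a \<Rightarrow> int"
    where "f s = of_bool (s \<in> S) - of_bool (- s \<in> S)"
      and "b s = of_bool (s \<in> S) + of_bool (- s \<in> S)" for s
  have "(\<Sum>s\<in>UNIV. of_int (f s) * \<psi> s) = 0" if \<psi>: "character \<psi>" for \<psi>
  proof (rule sqrt_minus_3_mult_cyclotomic_ring_imp_0[OF \<open>coprime 3 n\<close> \<open>n > 0\<close> _ _ t])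
    have "\<psi> s ^ n = 1" for s
    proof -
      have "\<psi> s ^ add_order s = 1"
        using character_multiple[OF \<psi>, of s "add_order s"] \<psi>
        by (simp add: multiple_add_order character_def)
      moreover have "add_order s dvd n"
        unfolding n_def by (intro dvd_prodI) auto
      ultimately show ?thesis by (auto simp: dvd_def power_mult)
    qed
    hence sum_mem: "(\<Sum>s\<in>UNIV. of_int (h s) * \<psi> s) \<in> cyclotomic_ring n" for h
      by (intro cyclotomic_ring_sum cyclotomic_ring_mult cyclotomic_ring_of_int cyclotomic_ring.root)
    show "(\<Sum>s\<in>UNIV. of_int (f s) * \<psi> s) \<in> cyclotomic_ring n" by (rule sum_mem)
    define w where "w s = (if s \<in> S then (1 + t) / 2 else if - s \<in> S then (1 - t) / 2 else 0)" for s
    have "is_eigenvalue (hermitian_adj (Cay S)) (\<Sum>s\<in>UNIV. w s * \<psi> s)"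
      unfolding w_def t_def by (rule hermitian_adj_Cay_character) fact+
    with integral obtain m where m: "(\<Sum>s\<in>UNIV. w s * \<psi> s) = of_int m"
      unfolding HS_integral_def by (metis Ints_cases)
    have w: "2 * w s = of_int (b s) + t * of_int (f s)" for s
      using assms(2) by (auto simp: w_def b_def f_def skew_symmetric_def)
    \<comment> \<open>Doubling avoids the denominator 2, since \<open>1 / 2\<close> need not lie in
      the ring.\<close>
    have "of_int (2 * m) = (\<Sum>s\<in>UNIV. 2 * w s * \<psi> s)"
      by (simp add: m[symmetric] sum_distrib_left mult.assoc)
    also have "\<dots> = (\<Sum>s\<in>UNIV. of_int (b s) * \<psi> s) + t * (\<Sum>s\<in>UNIV. of_int (f s) * \<psi> s)"
      unfolding w by (simp add: distrib_right sum.distrib sum_distrib_left mult.assoc)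
    finally have "t * (\<Sum>s\<in>UNIV. of_int (f s) * \<psi> s)
        = of_int (2 * m) - (\<Sum>s\<in>UNIV. of_int (b s) * \<psi> s)"
      by (simp add: algebra_simps)
    thus "t * (\<Sum>s\<in>UNIV. of_int (f s) * \<psi> s) \<in> cyclotomic_ring n"
      using cyclotomic_ring_diff[OF cyclotomic_ring_of_int sum_mem] by metis
  qed
  hence "complex_of_int (f s) = 0" for s
    by (rule characters_separate)
  hence f0: "f s = 0" for s by simp
  \<comment> \<open>Vanishing of \<open>f\<close> means that \<open>S\<close> is closed under
    negation, which skew-symmetry allows only for the empty set.\<close>
  have "s \<in> S \<longleftrightarrow> - s \<in> S" for s
    using f0[of s] by (simp add: f_def of_bool_def split: if_splits)
  thus "S = {}" using assms(2) by (auto simp: skew_symmetric_def)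
qed

end
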